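(* Let $\mathcal S$ be a small category, let $\mathcal C$ be a category, and let $X\colon\mathcal S\to\mathcal C$ be a functor (a categorical dynamical system). Let $\iota\colon\Delta I\Longrightarrow X$ be an invariant subsystem of $X$ equipped with a neighbourhood filter $\mathcal N_X(I)$. If there exists a Lyapunov basis for $\mathcal N_X(I)$, then $I$ is Lyapunov stable in $X$ (with respect to $\mathcal N_X(I)$).
   Context: Constant functor: for $I\in\mathcal C$, $\Delta I\colon\mathcal S\to\mathcal C$ is the functor with value $I$ on every object and $\mathrm{id}_I$ on every morphism. Invariant subsystem: a pair $(I,\iota)$ with $I\in\mathcal C$ and $\iota\colon\Delta I\Longrightarrow X$ a natural transformation all of whose components $\iota_s\colon I\to X(s)$ are monomorphisms. Thus $X(\alpha)\circ\iota_s=\iota_t$ for every $\alpha\colon s\to t$ in $\mathcal S$. Stagewise neighbourhood of $I$ in $X$: a family of monomorphisms $U=(\mu_s\colon U_s\hookrightarrow X(s))_{s\in\mathcal S}$ such that for every $s\in\mathcal S$ the morphism $\iota_s$ factors through $\mu_s$. The collection of these is denoted $\mathsf{Nbd}_X(I)$. For stagewise neighbourhoods $U=(\mu_s\colon U_s\hookrightarrow X(s))_s$ and $V=(\nu_s\colon V_s\hookrightarrow X(s))_s$, write $U\le V$ if for every $s\in\mathcal S$ there is a morphism $\phi_s\colon U_s\to V_s$ with $\nu_s\circ\phi_s=\mu_s$. This is a preorder. Neighbourhood filter of $I$ in $X$: a collection $\mathcal N_X(I)\subseteq\mathsf{Nbd}_X(I)$ such that (1) $\mathcal N_X(I)$ is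 nonempty; (2) if $U\in\mathcal N_X(I)$, $V\in\mathsf{Nbd}_X(I)$ and $U\le V$, then $V\in\mathcal N_X(I)$; (3) if $U,V\in\mathcal N_X(I)$, then there is $W\in\mathcal N_X(I)$ with $W\le U$ and $W\le V$. Forward-invariant: a stagewise neighbourhood $U=(\mu_s\colon U_s\hookrightarrow X(s))_s$ is forward-invariant if for every morphism $\alpha\colon s\to t$ in $\mathcal S$ the composite $X(\alpha)\circ\mu_s\colon U_s\to X(t)$ factors through $\mu_t\colon U_t\hookrightarrow X(t)$. Lyapunov basis for $\mathcal N_X(I)$: a subcollection $\mathcal B\subseteq\mathcal N_X(I)$ such that (1) every $V\in\mathcal B$ is forward-invariant; (2) for every $U\in\mathcal N_X(I)$ there is $V\in\mathcal B$ with $V\le U$. Lyapunov stability: $I$ is Lyapunov stable in $X$ if for every $U=(\mu_s\colon U_s\hookrightarrow X(s))_s\in\mathcal N_X(I)$ there exists $V=(\nu_s\colon V_s\hookrightarrow X(s))_s\in\mathcal N_X(I)$ such that $V\le U$ and, for every morphism $\alpha\colon s\to t$ in $\mathcal S$, the composite $X(\alpha)\circ\nu_s\colon V_s\to X(t)$ factors through $\mu_t\colon U_t\hookrightarrow X(t)$. *)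

theory Defs
  imports Main "HOL-Library.FuncSet"
begin

text \<open>
  Objects and arrows are carrier sets inside arbitrary types; \<open>Dom\<close>, \<open>Cod\<close>, \<open>Ident\<close> and \<open>Comp\<close>
  are meaningful on the carriers (respectively on composable pairs) only, and their values elsewhere
  are irrelevant. Composition is written in applicative order: \<open>g \<cdot> f\<close> is "first \<open>f\<close>, then \<open>g\<close>".
\<close>

record ('o, 'a) cat =
  Ob :: "'o set"
  Ar :: "'a set"
  Dom :: "'a \<Rightarrow> 'o"
  Cod :: "'a \<Rightarrow> 'o"
  Ident :: "'o \<Rightarrow> 'a"
  Comp :: "'a \<Rightarrow> 'a \<Rightarrow> 'a"  (infixl "\<cdot>\<index>" 70)

definition Hom :: "('o, 'a) cat \<Rightarrow> 'o \<Rightarrow> 'o \<Rightarrow> 'a set" where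
  "Hom C x y = {f \<in> Ar C. Dom C f = x \<and> Cod C f = y}"

locale category =
  fixes C :: "('o, 'a) cat"  (structure)
  assumes dom_closed: "f \<in> Ar C \<Longrightarrow> Dom C f \<in> Ob C"
    and cod_closed: "f \<in> Ar C \<Longrightarrow> Cod C f \<in> Ob C"
    and ident_in_hom: "x \<in> Ob C \<Longrightarrow> Ident C x \<in> Hom C x x"
    and comp_in_hom: "\<lbrakk>f \<in> Hom C x y; g \<in> Hom C y z\<rbrakk> \<Longrightarrow> g \<cdot> f \<in> Hom C x z"
    and comp_ident: "f \<in> Hom C x y \<Longrightarrow> f \<cdot> Ident C x = f"
    and ident_comp: "f \<in> Hom C x y \<Longrightarrow> Ident C y \<cdot> f = f"
    and comp_assoc: "\<lbrakk>f \<in> Hom C w x; g \<in> Hom C x y; h \<in> Hom C y z\<rbrakk>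
                       \<Longrightarrow> (h \<cdot> g) \<cdot> f = h \<cdot> (g \<cdot> f)"

definition monomorphism :: "('o, 'a) cat \<Rightarrow> 'a \<Rightarrow> bool" where
  "monomorphism C m \<longleftrightarrow> m \<in> Ar C \<and>
     (\<forall>w \<in> Ob C. \<forall>f \<in> Hom C w (Dom C m). \<forall>g \<in> Hom C w (Dom C m).
        m \<cdot>\<^bsub>C\<^esub> f = m \<cdot>\<^bsub>C\<^esub> g \<longrightarrow> f = g)"

definition factors_through :: "('o, 'a) cat \<Rightarrow> 'a \<Rightarrow> 'a \<Rightarrow> bool" where
  "factors_through C f m \<longleftrightarrow> (\<exists>h \<in> Hom C (Dom C f) (Dom C m). m \<cdot>\<^bsub>C\<^esub> h = f)"

record ('o, 'a, 'p, 'b) cat_functor =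
  on_ob :: "'o \<Rightarrow> 'p"
  on_ar :: "'a \<Rightarrow> 'b"

definition is_functor ::
  "('o, 'a) cat \<Rightarrow> ('p, 'b) cat \<Rightarrow> ('o, 'a, 'p, 'b) cat_functor \<Rightarrow> bool" where
  "is_functor S C F \<longleftrightarrow>
     (\<forall>s \<in> Ob S. on_ob F s \<in> Ob C) \<and>
     (\<forall>s \<in> Ob S. \<forall>t \<in> Ob S. \<forall>\<alpha> \<in> Hom S s t. on_ar F \<alpha> \<in> Hom C (on_ob F s) (on_ob F t)) \<and>
     (\<forall>s \<in> Ob S. on_ar F (Ident S s) = Ident C (on_ob F s)) \<and>
     (\<forall>r \<in> Ob S. \<forall>s \<in> Ob S. \<forall>t \<in> Ob S. \<forall>\<alpha> \<in> Hom S r s. \<forall>\<beta> \<in> Hom S s t.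
        on_ar F (\<beta> \<cdot>\<^bsub>S\<^esub> \<alpha>) = on_ar F \<beta> \<cdot>\<^bsub>C\<^esub> on_ar F \<alpha>)"

definition const_functor :: "('p, 'b) cat \<Rightarrow> 'p \<Rightarrow> ('o, 'a, 'p, 'b) cat_functor" where
  "const_functor C I = \<lparr>on_ob = (\<lambda>_. I), on_ar = (\<lambda>_. Ident C I)\<rparr>"

definition nat_transformation ::
  "('o, 'a) cat \<Rightarrow> ('p, 'b) cat \<Rightarrow> ('o, 'a, 'p, 'b) cat_functor \<Rightarrow> ('o, 'a, 'p, 'b) cat_functor
     \<Rightarrow> ('o \<Rightarrow> 'b) \<Rightarrow> bool" where
  "nat_transformation S C F G \<eta> \<longleftrightarrow>
     (\<forall>s \<in> Ob S. \<eta> s \<in> Hom C (on_ob F s) (on_ob G s)) \<and>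
     (\<forall>s \<in> Ob S. \<forall>t \<in> Ob S. \<forall>\<alpha> \<in> Hom S s t. on_ar G \<alpha> \<cdot>\<^bsub>C\<^esub> \<eta> s = \<eta> t \<cdot>\<^bsub>C\<^esub> on_ar F \<alpha>)"

definition invariant_subsystem ::
  "('o, 'a) cat \<Rightarrow> ('p, 'b) cat \<Rightarrow> ('o, 'a, 'p, 'b) cat_functor \<Rightarrow> 'p \<Rightarrow> ('o \<Rightarrow> 'b) \<Rightarrow> bool" where
  "invariant_subsystem S C X I \<iota> \<longleftrightarrow>
     I \<in> Ob C \<and> nat_transformation S C (const_functor C I) X \<iota> \<and>
     (\<forall>s \<in> Ob S. monomorphism C (\<iota> s))"

text \<open>
  A family \<open>(\<mu>\<^sub>s : U\<^sub>s \<rightarrow> X(s))\<^sub>s\<close> is represented by its arrows \<open>\<mu>\<close> alone, the object \<open>U\<^sub>s\<close> being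
  \<open>Dom C (\<mu> s)\<close>. Families are required to be \<open>extensional\<close> (\<open>undefined\<close> outside \<open>Ob S\<close>), so
  that they are determined by their members at the objects of \<open>S\<close>.
\<close>

definition Nbd ::
  "('o, 'a) cat \<Rightarrow> ('p, 'b) cat \<Rightarrow> ('o, 'a, 'p, 'b) cat_functor \<Rightarrow> ('o \<Rightarrow> 'b) \<Rightarrow> ('o \<Rightarrow> 'b) set" where
  "Nbd S C X \<iota> = {\<mu> \<in> extensional (Ob S). \<forall>s \<in> Ob S.
     monomorphism C (\<mu> s) \<and> Cod C (\<mu> s) = on_ob X s \<and> factors_through C (\<iota> s) (\<mu> s)}"

definition nbd_le ::
  "('o, 'a) cat \<Rightarrow> ('p, 'b) cat \<Rightarrow> ('o \<Rightarrow> 'b) \<Rightarrow> ('o \<Rightarrow> 'b) \<Rightarrow> bool" where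
  "nbd_le S C \<mu> \<nu> \<longleftrightarrow>
     (\<forall>s \<in> Ob S. \<exists>\<phi> \<in> Hom C (Dom C (\<mu> s)) (Dom C (\<nu> s)). \<nu> s \<cdot>\<^bsub>C\<^esub> \<phi> = \<mu> s)"

definition neighbourhood_filter ::
  "('o, 'a) cat \<Rightarrow> ('p, 'b) cat \<Rightarrow> ('o, 'a, 'p, 'b) cat_functor \<Rightarrow> ('o \<Rightarrow> 'b)
     \<Rightarrow> ('o \<Rightarrow> 'b) set \<Rightarrow> bool" where
  "neighbourhood_filter S C X \<iota> N \<longleftrightarrow>
     N \<subseteq> Nbd S C X \<iota> \<and>
     N \<noteq> {} \<and>
     (\<forall>U \<in> N. \<forall>V \<in> Nbd S C X \<iota>. nbd_le S C U V \<longrightarrow> V \<in> N) \<and>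
     (\<forall>U \<in> N. \<forall>V \<in> N. \<exists>W \<in> N. nbd_le S C W U \<and> nbd_le S C W V)"

definition forward_invariant ::
  "('o, 'a) cat \<Rightarrow> ('p, 'b) cat \<Rightarrow> ('o, 'a, 'p, 'b) cat_functor \<Rightarrow> ('o \<Rightarrow> 'b) \<Rightarrow> bool" where
  "forward_invariant S C X \<mu> \<longleftrightarrow>
     (\<forall>s \<in> Ob S. \<forall>t \<in> Ob S. \<forall>\<alpha> \<in> Hom S s t. factors_through C (on_ar X \<alpha> \<cdot>\<^bsub>C\<^esub> \<mu> s) (\<mu> t))"

definition lyapunov_basis ::
  "('o, 'a) cat \<Rightarrow> ('p, 'b) cat \<Rightarrow> ('o, 'a, 'p, 'b) cat_functor
     \<Rightarrow> ('o \<Rightarrow> 'b) set \<Rightarrow> ('o \<Rightarrow> 'b) set \<Rightarrow> bool" where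
  "lyapunov_basis S C X N B \<longleftrightarrow>
     B \<subseteq> N \<and>
     (\<forall>V \<in> B. forward_invariant S C X V) \<and>
     (\<forall>U \<in> N. \<exists>V \<in> B. nbd_le S C V U)"

definition lyapunov_stable ::
  "('o, 'a) cat \<Rightarrow> ('p, 'b) cat \<Rightarrow> ('o, 'a, 'p, 'b) cat_functor \<Rightarrow> ('o \<Rightarrow> 'b) set \<Rightarrow> bool" where
  "lyapunov_stable S C X N \<longleftrightarrow>
     (\<forall>\<mu> \<in> N. \<exists>\<nu> \<in> N. nbd_le S C \<nu> \<mu> \<and>
        (\<forall>s \<in> Ob S. \<forall>t \<in> Ob S. \<forall>\<alpha> \<in> Hom S s t. factors_through C (on_ar X \<alpha> \<cdot>\<^bsub>C\<^esub> \<nu> s) (\<mu> t)))"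

lemma const_functor_is_functor:
  assumes "category C" "I \<in> Ob C"
  shows "is_functor S C (const_functor C I)"
proof -
  interpret category C by fact
  show ?thesis
    using ident_in_hom[OF assms(2)] comp_ident[OF ident_in_hom[OF assms(2)]] assms(2)
    by (simp add: is_functor_def const_functor_def)
qed

lemma invariant_subsystem_iff:
  assumes "category C"
  shows "invariant_subsystem S C X I \<iota> \<longleftrightarrow>
     I \<in> Ob C \<and> (\<forall>s \<in> Ob S. \<iota> s \<in> Hom C I (on_ob X s) \<and> monomorphism C (\<iota> s)) \<and>
     (\<forall>s \<in> Ob S. \<forall>t \<in> Ob S. \<forall>\<alpha> \<in> Hom S s t. on_ar X \<alpha> \<cdot>\<^bsub>C\<^esub> \<iota> s = \<iota> t)"
proof -
  interpret category C by fact
  show ?thesis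
    by (auto simp: invariant_subsystem_def nat_transformation_def const_functor_def comp_ident)
qed

end

theory Submission
  imports Defs
begin

text \<open>A single basis member witnesses stability. Given a neighbourhood \<mu> in the filter,
  the basis supplies a forward-invariant \<nu> below it, which is again in the filter. For an arrow
  \<alpha> from s to t, X(\<alpha>) after \<open>\<nu> s\<close> factors through
  \<open>\<nu> t\<close> by forward invariance, and \<open>\<nu> t\<close> factors through
  \<open>\<mu> t\<close> because \<nu> lies below \<mu>. Composing the two factorizations, by
  \<open>factors_through_trans\<close>, gives the claim.\<close>

lemma (in category) factors_through_trans:
  assumes fm: "factors_through C f m" and mn: "factors_through C m n" and n: "n \<in> Ar C"
  shows "factors_through C f n"
proof -
  obtain h where h: "h \<in> Hom C (Dom C f) (Dom C m)" "m \<cdot> h = f"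
    using fm by (auto simp: factors_through_def)
  obtain k where k: "k \<in> Hom C (Dom C m) (Dom C n)" "n \<cdot> k = m"
    using mn by (auto simp: factors_through_def)
  \<comment> \<open>Associativity is available only for arrows in hom-sets, and
    \<open>factors_through\<close> alone does not place \<open>n\<close> in one.\<close>
  have "n \<in> Hom C (Dom C n) (Cod C n)"
    using n by (simp add: Hom_def)
  then have "n \<cdot> (k \<cdot> h) = f"
    using comp_assoc[OF h(1) k(1)] h(2) k(2) by metis
  with comp_in_hom[OF h(1) k(1)] show ?thesis
    by (auto simp: factors_through_def)
qed

text \<open>The comparison maps \<phi> are exactly the factoring arrows, so the order on families
  can feed \<open>factors_through_trans\<close>.\<close>

lemma nbd_le_iff_factors_through:
  "nbd_le S C \<mu> \<nu> \<longleftrightarrow> (\<forall>s \<in> Ob S. factors_through C (\<mu> s) (\<nu> s))"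
  by (simp add: nbd_le_def factors_through_def)

theorem lemma4p4:
  fixes S :: "('o, 'a) cat" and C :: "('p, 'b) cat"
    and X :: "('o, 'a, 'p, 'b) cat_functor"
    and I :: 'p and \<iota> :: "'o \<Rightarrow> 'b" and N :: "('o \<Rightarrow> 'b) set"
  assumes "category S"
    and "category C"
    and "is_functor S C X"
    and "invariant_subsystem S C X I \<iota>"
    and "neighbourhood_filter S C X \<iota> N"
    and "\<exists>B. lyapunov_basis S C X N B"
  shows "lyapunov_stable S C X N"
proof -
  interpret C: category C by fact
  obtain B where B: "lyapunov_basis S C X N B"
    using assms(6) by blast
  show ?thesis
    unfolding lyapunov_stable_def
  proof
    fix \<mu> assume "\<mu> \<in> N"
    \<comment> \<open>Members of the filter consist of monomorphisms, hence of arrows of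
      \<open>C\<close>.\<close>
    then have \<mu>: "\<mu> t \<in> Ar C" if "t \<in> Ob S" for t
      using assms(5) that by (auto simp: neighbourhood_filter_def Nbd_def monomorphism_def)
    obtain \<nu> where \<nu>: "\<nu> \<in> N" "forward_invariant S C X \<nu>" and le: "nbd_le S C \<nu> \<mu>"
      using B \<open>\<mu> \<in> N\<close> unfolding lyapunov_basis_def by blast
    \<comment> \<open>The intermediate arrow is \<open>\<nu> t\<close>; the comparison of \<nu> with
      \<mu> enters only at the target t.\<close>
    have "factors_through C (on_ar X \<alpha> \<cdot>\<^bsub>C\<^esub> \<nu> s) (\<mu> t)"
      if "s \<in> Ob S" "t \<in> Ob S" "\<alpha> \<in> Hom S s t" for s t \<alpha>
    proof (rule C.factors_through_trans)
      show "factors_through C (on_ar X \<alpha> \<cdot>\<^bsub>C\<^esub> \<nu> s) (\<nu> t)"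
        using \<nu>(2) that by (simp add: forward_invariant_def)
      show "factors_through C (\<nu> t) (\<mu> t)"
        using le that(2) by (simp add: nbd_le_iff_factors_through)
    qed (rule \<mu>[OF that(2)])
    with \<nu>(1) le show "\<exists>\<nu> \<in> N. nbd_le S C \<nu> \<mu> \<and>
        (\<forall>s \<in> Ob S. \<forall>t \<in> Ob S. \<forall>\<alpha> \<in> Hom S s t. factors_through C (on_ar X \<alpha> \<cdot>\<^bsub>C\<^esub> \<nu> s) (\<mu> t))"
      by blast
  qed
qed

end
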